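(* Consider the system $x(t+1)=g(x(t),u(t))$, $t\in\mathbb{N}$, with state in $\mathcal{X}\subseteq\mathbb{R}^n$ and input in $\mathcal{U}\subseteq\mathbb{R}^m$. Let $\omega:\mathbb{R}^n\to\mathbb{R}_{\ge 0}$ be a measurement function, let $M\in\mathbb{N}^*$, and let $q:\mathcal{X}\to\mathcal{U}^M$ be an admissible finite-step feedback (of length $M$) for the system. Assume that the resulting closed-loop system satisfies, for some $\beta\in\mathcal{KL}$, $$\omega(x(t,\xi,u_q))\le \beta(\omega(\xi),t)\qquad\text{for all }\xi\in\mathcal{X},\ t\in\mathbb{N},$$ with $\beta(r,M)<r$ for all $r>0$. Then the function $V:\mathbb{R}^n\to\mathbb{R}_{\ge0}$ defined by $V(\xi):=\omega(\xi)$ for all $\xi\in\mathbb{R}^n$ is a finite-step control Lyapunov function for the time step $M$ for the system, with $\underline\alpha=\overline\alpha=\mathrm{id}$ and with decay function $\alpha(r)=\beta(r,M)$.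
   Context: $\mathbb{N}$ are the nonnegative integers, $\mathbb{N}^*$ the positive integers. Class $\mathcal{K}$: continuous strictly increasing functions $\mathbb{R}_{\ge0}\to\mathbb{R}_{\ge0}$ vanishing at $0$; $\mathcal{K}_\infty$: unbounded class-$\mathcal{K}$ functions; $\mathcal{KL}$: continuous $\beta:\mathbb{R}_{\ge0}^2\to\mathbb{R}_{\ge0}$ with $\beta(\cdot,s)\in\mathcal{K}$ for each $s\geq 0$ and $\beta(r,\cdot)$ decreasing with $\beta(r,s)\to0$ as $s\to\infty$ for each $r\ge 0$. For functions vanishing at $0$, $\alpha<\gamma$ means $\alpha(s)<\gamma(s)$ for all $s>0$; $\mathrm{id}$ is the identity function. Measurement function: a continuous $\omega:\mathbb{R}^n\to\mathbb{R}_{\ge0}$ with $\omega^{-1}(0)\ne\emptyset$. Standing assumptions on the system: $g:\mathcal{X}\times\mathcal{U}\to\mathbb{R}^n$ is continuous and $\mathcal{K}$-bounded on $(\mathcal X,\mathcal U)$, i.e. for measurement functions $\omega_1$ on $\mathbb{R}^n$ and $\omega_2$ on $\mathbb{R}^m$ there are $\kappa_1,\kappa_2\in\mathcal{K}$ with $\omega_1(g(\xi,\mu))\le\kappa_1(\omega_1(\xi))+\kappa_2(\omega_2(\mu))$ for all $\xi\in\mathcal{X},\mu\in\mathcal{U}$. For $\mathbf{u}_M=(u(0),\dots,u(M-1))\in\mathcal{U}^M$ put $g^1(\xi,\mathbf{u}_M)=g(\xi,u(0))$ and $g^{j+1}(\xi,\mathbf{u}_M)=g(g^j(\xi,\mathbf{u}_M),u(j))$,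 $j=1,\dots,M-1$. A map $q:\mathcal{X}\to\mathcal{U}^M$ is an admissible finite-step feedback (of length $M$, with respect to $\omega$) if for all $\xi\in\mathcal{X}$ and $j=1,\dots,M$: (1) $g^j(\xi,q(\xi))\in\mathcal{X}$; (2) there is $\kappa_j\in\mathcal{K}$ (independent of $\xi$) with $\omega(g^j(\xi,q(\xi)))\le\kappa_j(\omega(\xi))$ for all $\xi\in\mathcal X$. It is applied by re-evaluating it every $M$ steps: the closed-loop trajectory $x_q(\cdot)=x(\cdot,\xi,u_q)$ is given by $x_q(0)=\xi$ and $x_q(kM+j+1)=g^{j+1}(x_q(kM),q(x_q(kM)))$ for $k\in\mathbb{N}$, $j=0,\dots,M-1$, and $u_q$ is the resulting input sequence. A continuous $V:\mathbb{R}^n\to\mathbb{R}_{\ge0}$ with $\underline\alpha(\omega(\xi))\le V(\xi)\le\overline\alpha(\omega(\xi))$ for all $\xi\in\mathbb{R}^n$, where $\underline\alpha,\overline\alpha\in\mathcal{K}_\infty$, is a finite-step control Lyapunov function for the time step $M$ if there exist an admissible finite-step feedback $q:\mathcal{X}\to\mathcal{U}^M$ and a function $\alpha\in\mathcal{K}_\infty$, $\alpha<\mathrm{id}$ (the decay function), such that $V(x(M,\xi,u_q))\le\alpha(V(\xi))$ for all $\xi\in\mathcal{X}$.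
   Formalization: β(·,M) may be bounded, hence not K∞ (e.g. β(r,s)=r/(1+sr), g=0), so it is shown to be the decay function only when unbounded; in general V is shown to be a CLF with bounds id, feedback q and some K∞ decay function, and V(x(M,ξ,u_q))≤β(V(ξ),M) with β(·,M) in K and below id. *)

theory Defs
  imports "HOL-Analysis.Analysis"
begin

text \<open>Comparison functions are total functions on the reals of which only the values at
  nonnegative arguments matter; nonnegativity of the values follows from \<open>\<alpha> 0 = 0\<close> and
  monotonicity.\<close>

definition class_K :: "(real \<Rightarrow> real) \<Rightarrow> bool" where
  "class_K \<alpha> \<longleftrightarrow> continuous_on {0..} \<alpha> \<and> strict_mono_on {0..} \<alpha> \<and> \<alpha> 0 = 0"

definition class_K_inf :: "(real \<Rightarrow> real) \<Rightarrow> bool" where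
  "class_K_inf \<alpha> \<longleftrightarrow> class_K \<alpha> \<and> \<not> bdd_above (\<alpha> ` {0..})"

definition class_KL :: "(real \<Rightarrow> real \<Rightarrow> real) \<Rightarrow> bool" where
  "class_KL \<beta> \<longleftrightarrow>
     continuous_on ({0..} \<times> {0..}) (\<lambda>(r, s). \<beta> r s) \<and>
     (\<forall>s\<ge>0. class_K (\<lambda>r. \<beta> r s)) \<and>
     (\<forall>r\<ge>0. antimono_on {0..} (\<beta> r) \<and> (\<beta> r \<longlongrightarrow> 0) at_top)"

definition less_fun_pos :: "(real \<Rightarrow> real) \<Rightarrow> (real \<Rightarrow> real) \<Rightarrow> bool" where
  "less_fun_pos \<alpha> \<gamma> \<longleftrightarrow> (\<forall>s>0. \<alpha> s < \<gamma> s)"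

definition measurement_function :: "('a::topological_space \<Rightarrow> real) \<Rightarrow> bool" where
  "measurement_function \<omega> \<longleftrightarrow>
     continuous_on UNIV \<omega> \<and> (\<forall>x. 0 \<le> \<omega> x) \<and> \<omega> -` {0} \<noteq> {}"

definition K_bounded ::
  "('a \<Rightarrow> 'b \<Rightarrow> 'a) \<Rightarrow> 'a set \<Rightarrow> 'b set \<Rightarrow> ('a \<Rightarrow> real) \<Rightarrow> ('b \<Rightarrow> real) \<Rightarrow> bool" where
  "K_bounded g X U \<omega>1 \<omega>2 \<longleftrightarrow>
     (\<exists>\<kappa>1 \<kappa>2. class_K \<kappa>1 \<and> class_K \<kappa>2 \<and>
        (\<forall>\<xi>\<in>X. \<forall>\<mu>\<in>U. \<omega>1 (g \<xi> \<mu>) \<le> \<kappa>1 (\<omega>1 \<xi>) + \<kappa>2 (\<omega>2 \<mu>)))"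

text \<open>The solution \<open>x(t, \<xi>, u)\<close>; for \<open>1 \<le> j \<le> M\<close> it is also \<open>g\<^sup>j(\<xi>, u)\<close> with
  \<open>u\<close> in \<open>U\<^sup>M\<close>, since only \<open>u 0, \<dots>, u (j - 1)\<close> enter. The set \<open>U\<^sup>M\<close> is
  \<open>{..<M} \<rightarrow>\<^sub>E U\<close>.\<close>

primrec solution :: "('a \<Rightarrow> 'b \<Rightarrow> 'a) \<Rightarrow> 'a \<Rightarrow> (nat \<Rightarrow> 'b) \<Rightarrow> nat \<Rightarrow> 'a" where
  "solution g \<xi> u 0 = \<xi>"
| "solution g \<xi> u (Suc t) = g (solution g \<xi> u t) (u t)"

definition admissible_feedback ::
  "('a \<Rightarrow> 'b \<Rightarrow> 'a) \<Rightarrow> 'a set \<Rightarrow> 'b set \<Rightarrow> ('a \<Rightarrow> real) \<Rightarrow> nat \<Rightarrow> ('a \<Rightarrow> nat \<Rightarrow> 'b) \<Rightarrow> bool" where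
  "admissible_feedback g X U \<omega> M q \<longleftrightarrow>
     q \<in> X \<rightarrow> ({..<M} \<rightarrow>\<^sub>E U) \<and>
     (\<forall>j\<in>{1..M}. (\<forall>\<xi>\<in>X. solution g \<xi> (q \<xi>) j \<in> X) \<and>
        (\<exists>\<kappa>. class_K \<kappa> \<and> (\<forall>\<xi>\<in>X. \<omega> (solution g \<xi> (q \<xi>) j) \<le> \<kappa> (\<omega> \<xi>))))"

text \<open>The state at time \<open>k * M\<close>, where the feedback is re-evaluated.\<close>

primrec sampled_state ::
  "('a \<Rightarrow> 'b \<Rightarrow> 'a) \<Rightarrow> nat \<Rightarrow> ('a \<Rightarrow> nat \<Rightarrow> 'b) \<Rightarrow> 'a \<Rightarrow> nat \<Rightarrow> 'a" where
  "sampled_state g M q \<xi> 0 = \<xi>"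
| "sampled_state g M q \<xi> (Suc k) =
     solution g (sampled_state g M q \<xi> k) (q (sampled_state g M q \<xi> k)) M"

definition feedback_input ::
  "('a \<Rightarrow> 'b \<Rightarrow> 'a) \<Rightarrow> nat \<Rightarrow> ('a \<Rightarrow> nat \<Rightarrow> 'b) \<Rightarrow> 'a \<Rightarrow> nat \<Rightarrow> 'b" where
  "feedback_input g M q \<xi> t = q (sampled_state g M q \<xi> (t div M)) (t mod M)"

definition closed_loop ::
  "('a \<Rightarrow> 'b \<Rightarrow> 'a) \<Rightarrow> nat \<Rightarrow> ('a \<Rightarrow> nat \<Rightarrow> 'b) \<Rightarrow> 'a \<Rightarrow> nat \<Rightarrow> 'a" where
  "closed_loop g M q \<xi> = solution g \<xi> (feedback_input g M q \<xi>)"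

lemma closed_loop_0: "closed_loop g M q \<xi> 0 = \<xi>"
  by (simp add: closed_loop_def)

lemma closed_loop_within:
  assumes "j \<le> M" and "closed_loop g M q \<xi> (k * M) = sampled_state g M q \<xi> k"
  shows "closed_loop g M q \<xi> (k * M + j) =
     solution g (sampled_state g M q \<xi> k) (q (sampled_state g M q \<xi> k)) j"
  using assms(1)
proof (induction j)
  case 0
  show ?case using assms(2) by simp
next
  case (Suc j)
  then have "(k * M + j) div M = k" "(k * M + j) mod M = j" by auto
  with Suc show ?case by (simp add: closed_loop_def feedback_input_def)
qed

lemma closed_loop_sampled: "closed_loop g M q \<xi> (k * M) = sampled_state g M q \<xi> k"
proof (induction k)
  case 0
  show ?case by (simp add: closed_loop_0)
next
  case (Suc k)
  from closed_loop_within[OF order_refl Suc] show ?case by (simp add: add.commute)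
qed

text \<open>The recursion by which the closed-loop trajectory is specified.\<close>

lemma closed_loop_step:
  assumes "j < M"
  shows "closed_loop g M q \<xi> (k * M + j + 1) =
     solution g (closed_loop g M q \<xi> (k * M)) (q (closed_loop g M q \<xi> (k * M))) (j + 1)"
  using closed_loop_within[of "j + 1" M g q \<xi> k] assms by (simp add: closed_loop_sampled)

definition finite_step_clf_with ::
  "('a::topological_space \<Rightarrow> 'b \<Rightarrow> 'a) \<Rightarrow> 'a set \<Rightarrow> 'b set \<Rightarrow> ('a \<Rightarrow> real) \<Rightarrow> nat \<Rightarrow> ('a \<Rightarrow> real) \<Rightarrow>
   (real \<Rightarrow> real) \<Rightarrow> (real \<Rightarrow> real) \<Rightarrow> ('a \<Rightarrow> nat \<Rightarrow> 'b) \<Rightarrow> (real \<Rightarrow> real) \<Rightarrow> bool" where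
  "finite_step_clf_with g X U \<omega> M V \<alpha>_lo \<alpha>_up q \<alpha> \<longleftrightarrow>
     continuous_on UNIV V \<and> (\<forall>\<xi>. 0 \<le> V \<xi>) \<and>
     class_K_inf \<alpha>_lo \<and> class_K_inf \<alpha>_up \<and>
     (\<forall>\<xi>. \<alpha>_lo (\<omega> \<xi>) \<le> V \<xi> \<and> V \<xi> \<le> \<alpha>_up (\<omega> \<xi>)) \<and>
     admissible_feedback g X U \<omega> M q \<and>
     class_K_inf \<alpha> \<and> less_fun_pos \<alpha> id \<and>
     (\<forall>\<xi>\<in>X. V (closed_loop g M q \<xi> M) \<le> \<alpha> (V \<xi>))"

text \<open>Pitfall: the decay function must be unbounded, whereas \<open>\<lambda>r. \<beta> r M\<close> for a class-KL
  function \<open>\<beta>\<close> with \<open>\<beta> r M < r\<close> may be bounded: take \<open>\<beta> r s = r / (1 + s * r)\<close> and the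
  system \<open>g = 0\<close>, \<open>\<omega> = norm\<close>. Then \<open>\<lambda>r. max (\<beta> r M) (r / 2)\<close> is a decay function.\<close>

definition finite_step_clf ::
  "('a::topological_space \<Rightarrow> 'b \<Rightarrow> 'a) \<Rightarrow> 'a set \<Rightarrow> 'b set \<Rightarrow> ('a \<Rightarrow> real) \<Rightarrow> nat \<Rightarrow> ('a \<Rightarrow> real) \<Rightarrow> bool" where
  "finite_step_clf g X U \<omega> M V \<longleftrightarrow>
     (\<exists>\<alpha>_lo \<alpha>_up q \<alpha>. finite_step_clf_with g X U \<omega> M V \<alpha>_lo \<alpha>_up q \<alpha>)"

end

theory Submission
  imports Defs
begin

text \<open>The function \<open>\<lambda>r. \<beta> r M\<close> is of class K and lies below the identity, but it may be bounded.
  Its maximum with \<open>r / 2\<close> is still below the identity and dominates the decay, and it is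
  unbounded, so it serves as decay function in every case.\<close>

lemma not_bdd_above_if_half_le:
  fixes \<alpha> :: "real \<Rightarrow> real"
  assumes "\<And>r. 0 \<le> r \<Longrightarrow> r / 2 \<le> \<alpha> r"
  shows "\<not> bdd_above (\<alpha> ` {0..})"
proof
  assume "bdd_above (\<alpha> ` {0..})"
  then obtain B where B: "\<And>r. 0 \<le> r \<Longrightarrow> \<alpha> r \<le> B"
    by (auto simp: bdd_above_def)
  \<comment> \<open>The argument is chosen nonnegative with half equal to
    \<open>\<bar>B\<bar> + 1\<close>, which exceeds any bound \<open>B\<close> of either
    sign.\<close>
  have "(2 * \<bar>B\<bar> + 2) / 2 \<le> B"
    using assms[of "2 * \<bar>B\<bar> + 2"] B[of "2 * \<bar>B\<bar> + 2"] by simp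
  then show False by simp
qed

lemma class_K_inf_id: "class_K_inf id"
  using not_bdd_above_if_half_le[of id]
  by (auto simp: class_K_inf_def class_K_def intro: strict_mono_onI)

lemma class_K_inf_max_half:
  assumes "class_K \<alpha>"
  shows "class_K_inf (\<lambda>r. max (\<alpha> r) (r / 2))"
proof -
  have "continuous_on {0..} (\<lambda>r. max (\<alpha> r) (r / 2))"
    using assms by (auto simp: class_K_def intro!: continuous_intros)
  moreover have "strict_mono_on {0..} (\<lambda>r. max (\<alpha> r) (r / 2))"
  proof (rule strict_mono_onI)
    fix r s :: real
    assume "r \<in> {0..}" "s \<in> {0..}" "r < s"
    moreover from this have "\<alpha> r < \<alpha> s"
      using assms unfolding class_K_def by (blast intro: strict_mono_onD)
    \<comment> \<open>Whichever term attains the maximum at \<open>r\<close> is strictly exceeded by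
      the same term at \<open>s\<close>.\<close>
    ultimately show "max (\<alpha> r) (r / 2) < max (\<alpha> s) (s / 2)"
      by (auto simp: max_def)
  qed
  moreover have "\<not> bdd_above ((\<lambda>r. max (\<alpha> r) (r / 2)) ` {0..})"
    by (rule not_bdd_above_if_half_le) simp
  ultimately show ?thesis
    using assms by (simp add: class_K_inf_def class_K_def)
qed

text \<open>For V = \<omega> the sandwich bounds are equalities, so \<open>id\<close> serves on both
  sides, and only the decay is left to supply. The function \<alpha> stays arbitrary because two
  different decay functions are inserted below.\<close>

lemma finite_step_clf_with_measurement_function:
  assumes "measurement_function \<omega>" and "admissible_feedback g X U \<omega> M q"
    and "class_K_inf \<alpha>" and "less_fun_pos \<alpha> id"
    and "\<And>\<xi>. \<xi> \<in> X \<Longrightarrow> \<omega> (closed_loop g M q \<xi> M) \<le> \<alpha> (\<omega> \<xi>)"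
  shows "finite_step_clf_with g X U \<omega> M \<omega> id id q \<alpha>"
  using assms class_K_inf_id
  by (simp add: finite_step_clf_with_def measurement_function_def)

text \<open>The conclusion is split according to what boundedness of \<beta>(., M) can spoil: the
  Lyapunov property itself and the decay estimate hold always, while \<beta>(., M) is itself
  certified as decay function once it is unbounded.\<close>

theorem theorem9:
  fixes g :: "real ^ 'n \<Rightarrow> real ^ 'm \<Rightarrow> real ^ 'n"
    and X :: "(real ^ 'n) set" and U :: "(real ^ 'm) set"
    and \<omega> \<omega>1 V :: "real ^ 'n \<Rightarrow> real" and \<omega>2 :: "real ^ 'm \<Rightarrow> real"
    and M :: nat and q :: "real ^ 'n \<Rightarrow> nat \<Rightarrow> real ^ 'm"
    and \<beta> :: "real \<Rightarrow> real \<Rightarrow> real"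
  assumes "continuous_on (X \<times> U) (\<lambda>(\<xi>, \<mu>). g \<xi> \<mu>)"
    and "measurement_function \<omega>1" and "measurement_function \<omega>2"
    and "K_bounded g X U \<omega>1 \<omega>2"
    and "measurement_function \<omega>"
    and "M \<ge> 1"
    and "admissible_feedback g X U \<omega> M q"
    and "class_KL \<beta>"
    and "\<And>\<xi> t. \<xi> \<in> X \<Longrightarrow> \<omega> (closed_loop g M q \<xi> t) \<le> \<beta> (\<omega> \<xi>) (real t)"
    and "\<And>r. r > 0 \<Longrightarrow> \<beta> r (real M) < r"
    and "\<And>\<xi>. V \<xi> = \<omega> \<xi>"
  shows "finite_step_clf g X U \<omega> M V
    \<and> (\<exists>\<alpha>. finite_step_clf_with g X U \<omega> M V id id q \<alpha>)
    \<and> (class_K (\<lambda>r. \<beta> r (real M)) \<and> less_fun_pos (\<lambda>r. \<beta> r (real M)) id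
       \<and> (\<forall>\<xi>\<in>X. V (closed_loop g M q \<xi> M) \<le> \<beta> (V \<xi>) (real M)))
    \<and> (\<not> bdd_above ((\<lambda>r. \<beta> r (real M)) ` {0..})
       \<longrightarrow> finite_step_clf_with g X U \<omega> M V id id q (\<lambda>r. \<beta> r (real M)))"
proof -
  define \<alpha> where "\<alpha> = (\<lambda>r. \<beta> r (real M))"
  have V: "V = \<omega>" using assms(11) by auto
  have K: "class_K \<alpha>"
    using assms(8) by (simp add: class_KL_def \<alpha>_def)
  have less: "less_fun_pos \<alpha> id"
    using assms(10) by (simp add: less_fun_pos_def \<alpha>_def)
  \<comment> \<open>This is the trajectory estimate at the single time t = M.\<close>
  have decay: "\<omega> (closed_loop g M q \<xi> M) \<le> \<alpha> (\<omega> \<xi>)" if "\<xi> \<in> X" for \<xi>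
    using assms(9)[OF that] by (simp add: \<alpha>_def)
  note clf = finite_step_clf_with_measurement_function[OF assms(5,7)]
  have half: "finite_step_clf_with g X U \<omega> M \<omega> id id q (\<lambda>r. max (\<alpha> r) (r / 2))"
  proof (rule clf)
    show "class_K_inf (\<lambda>r. max (\<alpha> r) (r / 2))"
      by (rule class_K_inf_max_half[OF K])
    \<comment> \<open>For r > 0 both terms of the maximum are below r.\<close>
    show "less_fun_pos (\<lambda>r. max (\<alpha> r) (r / 2)) id"
      using less by (simp add: less_fun_pos_def)
  qed (use decay in \<open>simp add: le_max_iff_disj\<close>)
  \<comment> \<open>Unboundedness is exactly what lifts \<alpha> from \<open>class_K\<close> to
    \<open>class_K_inf\<close>.\<close>
  have "finite_step_clf_with g X U \<omega> M \<omega> id id q \<alpha>" if "\<not> bdd_above (\<alpha> ` {0..})"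
    using that K less decay by (intro clf) (auto simp: class_K_inf_def)
  moreover have "finite_step_clf g X U \<omega> M \<omega>"
    using half unfolding finite_step_clf_def by blast
  ultimately show ?thesis
    using half K less decay unfolding V \<alpha>_def by blast
qed

end
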